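(* Let $v\in\mathbb{Z}^3$ be a nonzero integer vector. Then there exist $w_1,w_2\in\mathbb{Z}^3$ such that $v,w_1,w_2$ is an orthoregular system (an integral orthoregular basis of $\mathbb{R}^3$) if and only if the Euclidean norm $|v|$ is an integer. In particular, $E_{\mathbb{Z}}(3,1)=3$.
   Context: A system $v_1,\ldots,v_k$ of vectors in $\mathbb{R}^n$ is called orthoregular if (i) $v_i\perp v_j$ (standard inner product) for $i\neq j$, and (ii) $|v_i|=|v_j|\neq 0$ for all $i,j$ ($|\cdot|$ the Euclidean norm); the common value $|v_i|$ is the length of the system. For an orthoregular system $S\subset\mathbb{Z}^n$, $E(S)$ denotes the maximum number of vectors in an orthoregular system of integer vectors in $\mathbb{Z}^n$ containing $S$. For an integer $0<k<n$ and $K\subseteq\mathbb{R}$, $E_K(n,k)$ denotes the minimum of $E(S)$ over all orthoregular systems $S\subset\mathbb{Z}^n$ with $k$ elements whose length lies in $K$. *)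

theory Defs
  imports "HOL-Analysis.Analysis"
begin

text \<open>
  Systems of vectors are lists, so that a repeated vector counts as a failure of orthogonality.
  The dimension \<open>n\<close> is \<open>CARD('n)\<close>.
\<close>

definition orthoregular :: "(real ^ 'n) list \<Rightarrow> bool" where
  "orthoregular vs \<longleftrightarrow>
     (\<forall>i < length vs. \<forall>j < length vs. i \<noteq> j \<longrightarrow> orthogonal (vs ! i) (vs ! j)) \<and>
     (\<forall>i < length vs. \<forall>j < length vs. norm (vs ! i) = norm (vs ! j) \<and> norm (vs ! j) \<noteq> 0)"

text \<open>The common norm of the vectors; meaningful only for a nonempty orthoregular system.\<close>

definition system_length :: "(real ^ 'n) list \<Rightarrow> real" where
  "system_length vs = norm (hd vs)"

definition integer_vectors :: "(real ^ 'n) set" where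
  "integer_vectors = {v. \<forall>i. v $ i \<in> \<int>}"

text \<open>
  \<open>E(S)\<close>. The set of sizes is finite because orthoregular systems are linearly independent,
  and it is nonempty when \<open>S\<close> is an orthoregular system of integer vectors.
\<close>

definition max_extension :: "(real ^ 'n) list \<Rightarrow> nat" where
  "max_extension S =
     Max {length T | T. orthoregular T \<and> set T \<subseteq> integer_vectors \<and> set S \<subseteq> set T}"

text \<open>
  \<open>E\<^sub>K(n,k)\<close> for \<open>0 < k < n = CARD('n)\<close>; the type argument carries \<open>n\<close>.
\<close>

definition min_max_extension :: "real set \<Rightarrow> 'n::finite itself \<Rightarrow> nat \<Rightarrow> nat" where
  "min_max_extension K _ k =
     Min {max_extension S | S :: (real ^ 'n) list.
            orthoregular S \<and> set S \<subseteq> integer_vectors \<and> length S = k \<and> system_length S \<in> K}"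

end

(* A vector (a,b,c) of integer length d is encoded by the singular Hermitian matrix with
   diagonal d + a, d - a and off-diagonal entry b + ci. Euclidean descent over the Gaussian
   integers writes such a matrix as an integer multiple of z z^*, and z in Z[i]^2, read as a
   quaternion, yields the Euler-Rodrigues matrix, whose other two rows complete (a,b,c) to a
   basis. Conversely, the determinant of an integral orthoregular basis is an integer with
   absolute value |v|^3, so the integer |v|^2 has a square cube and is a square. *)

theory Submission
  imports Defs
begin

section \<open>Integer arithmetic: rank-one Hermitian matrices, completion of triples,
  squares\<close>

lemma nearest_multiple:
  fixes x P :: int
  assumes "P > 0"
  obtains s where "\<bar>2 * (x - P * s)\<bar> \<le> P"
proof -
  \<comment> \<open>Rounding: \<open>s\<close> is the floor of x/P + 1/2.\<close>
  define s where "s = (2 * x + P) div (2 * P)"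
  define r where "r = (2 * x + P) mod (2 * P)"
  have "2 * x + P = 2 * P * s + r"
    unfolding s_def r_def by simp
  moreover have "0 \<le> r" "r < 2 * P"
    unfolding r_def using assms by simp_all
  ultimately have "\<bar>2 * (x - P * s)\<bar> \<le> P"
    by (simp add: algebra_simps abs_le_iff)
  then show ?thesis by (rule that)
qed

text \<open>With \<open>z = m + n\<i>\<close> and \<open>w = p + q\<i>\<close> the conclusion reads
  \<open>P = k|z|\<^sup>2\<close>, \<open>Q = k|w|\<^sup>2\<close> and \<open>x + y\<i> = k z w\<^sup>*\<close>.\<close>

lemma hermitian_rank_one:
  fixes P Q x y :: int
  assumes "P \<ge> 0" "Q \<ge> 0" "P * Q = x\<^sup>2 + y\<^sup>2"
  shows "\<exists>k m n p q. P = k * (m\<^sup>2 + n\<^sup>2) \<and> Q = k * (p\<^sup>2 + q\<^sup>2) \<and>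
           x = k * (m * p + n * q) \<and> y = k * (n * p - m * q)"
  using assms
proof (induction "nat (P + Q)" arbitrary: P Q x y rule: less_induct)
  case less
  \<comment> \<open>The pivot is the smaller diagonal entry. Only the sum of \<open>A\<close> and
    \<open>B\<close> is tied to \<open>P + Q\<close>, and \<open>x\<close>, \<open>y\<close> are
    fresh, so both orders of the diagonal are covered.\<close>
  have ordered: "\<exists>k m n p q. A = k * (m\<^sup>2 + n\<^sup>2) \<and> B = k * (p\<^sup>2 + q\<^sup>2) \<and>
           x = k * (m * p + n * q) \<and> y = k * (n * p - m * q)"
    if sum: "A + B = P + Q" and le: "A \<le> B" and nonneg: "0 \<le> A" and eq: "A * B = x\<^sup>2 + y\<^sup>2"
    for A B x y :: int
  proof (cases "A = 0")
    case True
    with eq have "x = 0" "y = 0"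
      by simp_all
    \<comment> \<open>The factorization with z = 0, w = 1 and k = B.\<close>
    with True have "A = B * (0\<^sup>2 + 0\<^sup>2) \<and> B = B * (1\<^sup>2 + 0\<^sup>2) \<and>
        x = B * (0 * 1 + 0 * 0) \<and> y = B * (0 * 1 - 0 * 0)"
      by simp
    then show ?thesis by blast
  next
    case False
    with nonneg have pos: "A > 0" by simp
    obtain s where s: "\<bar>2 * (x - A * s)\<bar> \<le> A"
      using nearest_multiple[OF pos] .
    obtain r where r: "\<bar>2 * (y - A * r)\<bar> \<le> A"
      using nearest_multiple[OF pos] .
    \<comment> \<open>Subtracting s + ri times the first row from the second, and the conjugate
      multiple for columns, leaves the determinant 0. The new off-diagonal entry is u + vi and the
      new second diagonal entry is R.\<close>
    define u v R where "u = x - A * s" and "v = y - A * r"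
      and "R = B - 2 * (x * s + y * r) + A * (s\<^sup>2 + r\<^sup>2)"
    have R: "A * R = u\<^sup>2 + v\<^sup>2"
      using eq unfolding R_def u_def v_def by algebra
    have "0 \<le> A * R" unfolding R by simp
    with pos have "0 \<le> R" by (simp add: zero_le_mult_iff)
    \<comment> \<open>Both residues are at most A/2 in absolute value, so A R = u^2 + v^2 is at most
      A^2/2. Hence R < A \<le> B and the trace drops.\<close>
    have "(2 * u)\<^sup>2 \<le> A\<^sup>2" "(2 * v)\<^sup>2 \<le> A\<^sup>2"
      using s r pos unfolding u_def v_def by (simp_all only: abs_le_square_iff[symmetric] abs_of_pos)
    then have "A * (2 * R) \<le> A * A"
      using R by (simp add: power2_eq_square)
    with pos have "2 * R \<le> A" by (simp only: mult_le_cancel_left_pos)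
    with pos have "R < A" by linarith
    then have "nat (A + R) < nat (P + Q)"
      using le pos sum by linarith
    then obtain k m n p q where k: "A = k * (m\<^sup>2 + n\<^sup>2)" "R = k * (p\<^sup>2 + q\<^sup>2)"
        "u = k * (m * p + n * q)" "v = k * (n * p - m * q)"
      using less.hyps[OF _ nonneg \<open>0 \<le> R\<close> R] by blast
    have x: "x = u + A * s" and y: "y = v + A * r"
      and B: "B = R + 2 * (u * s + v * r) + A * (s\<^sup>2 + r\<^sup>2)"
      unfolding u_def v_def R_def by (simp_all add: algebra_simps power2_eq_square)
    \<comment> \<open>Undoing the row and column operation keeps z and replaces w by w + z (s -
      ri).\<close>
    let ?p = "p + m * s + n * r" and ?q = "q + n * s - m * r"
    have "B = k * (?p\<^sup>2 + ?q\<^sup>2)"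
      unfolding B k by algebra
    moreover have "x = k * (m * ?p + n * ?q)"
      unfolding x k by algebra
    moreover have "y = k * (n * ?p - m * ?q)"
      unfolding y k by algebra
    ultimately show ?thesis using k(1) by blast
  qed
  show ?case
  proof (cases "P \<le> Q")
    case True
    then show ?thesis
      by (rule ordered[OF refl _ less.prems(1,3)])
  next
    case False
    \<comment> \<open>Swapping the diagonal entries conjugates the off-diagonal one and exchanges z
      and w.\<close>
    have "Q + P = P + Q" "Q \<le> P" "Q * P = x\<^sup>2 + (- y)\<^sup>2"
      using less.prems(3) False by (simp_all add: mult.commute)
    from ordered[OF this(1,2) less.prems(2) this(3)]
    obtain k m n p q where "Q = k * (m\<^sup>2 + n\<^sup>2)" "P = k * (p\<^sup>2 + q\<^sup>2)"
        "x = k * (m * p + n * q)" "- y = k * (n * p - m * q)"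
      by blast
    then have "P = k * (p\<^sup>2 + q\<^sup>2) \<and> Q = k * (m\<^sup>2 + n\<^sup>2) \<and>
           x = k * (p * m + q * n) \<and> y = k * (q * m - p * n)"
      by (simp add: algebra_simps)
    then show ?thesis by blast
  qed
qed

text \<open>The rows are k/2 times those of the Euler-Rodrigues matrix. They are integral even for
  odd k: off the diagonal the usual factor 2 cancels the half, and on the diagonal the trace
  relation 2d = k(|z|^2 + |w|^2) absorbs it.\<close>

lemma integer_triple_completion:
  fixes a b c d :: int
  assumes "d \<ge> 0" and abcd: "a\<^sup>2 + b\<^sup>2 + c\<^sup>2 = d\<^sup>2"
  obtains a1 b1 c1 a2 b2 c2 :: int where
    "a * a1 + b * b1 + c * c1 = 0" "a * a2 + b * b2 + c * c2 = 0"
    "a1 * a2 + b1 * b2 + c1 * c2 = 0"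
    "a1\<^sup>2 + b1\<^sup>2 + c1\<^sup>2 = d\<^sup>2" "a2\<^sup>2 + b2\<^sup>2 + c2\<^sup>2 = d\<^sup>2"
proof -
  have "a\<^sup>2 \<le> d\<^sup>2"
    unfolding abcd[symmetric] by simp
  with \<open>d \<ge> 0\<close> have "\<bar>a\<bar> \<le> d"
    by (simp add: abs_le_square_iff[symmetric])
  then have "0 \<le> d + a" "0 \<le> d - a" by simp_all
  moreover have "(d + a) * (d - a) = b\<^sup>2 + c\<^sup>2"
    using abcd by algebra
  ultimately obtain k m n p q where k: "d + a = k * (m\<^sup>2 + n\<^sup>2)" "d - a = k * (p\<^sup>2 + q\<^sup>2)"
      and bc: "b = k * (m * p + n * q)" "c = k * (n * p - m * q)"
    using hermitian_rank_one by blast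
  then have a: "a = d - k * (p\<^sup>2 + q\<^sup>2)" and d: "2 * d = k * (m\<^sup>2 + n\<^sup>2 + p\<^sup>2 + q\<^sup>2)"
    by (simp_all add: algebra_simps)
  \<comment> \<open>The diagonal entries \<open>d - k(m\<^sup>2 + q\<^sup>2)\<close> and \<open>d - k(m\<^sup>2 + p\<^sup>2)\<close> are the usual
    \<open>k(n\<^sup>2 - m\<^sup>2 + p\<^sup>2 - q\<^sup>2)/2\<close> and \<open>k(n\<^sup>2 - m\<^sup>2 - p\<^sup>2 + q\<^sup>2)/2\<close>
    of the Euler-Rodrigues matrix.\<close>
  show ?thesis
  proof (rule that)
    show "a * (k * (m * p - n * q)) + b * (d - k * (m\<^sup>2 + q\<^sup>2)) + c * (- k * (p * q + m * n)) = 0"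
      unfolding a bc using d by algebra
    show "a * (- k * (m * q + n * p)) + b * (k * (m * n - p * q)) + c * (d - k * (m\<^sup>2 + p\<^sup>2)) = 0"
      unfolding a bc using d by algebra
    show "(k * (m * p - n * q)) * (- k * (m * q + n * p))
        + (d - k * (m\<^sup>2 + q\<^sup>2)) * (k * (m * n - p * q))
        + (- k * (p * q + m * n)) * (d - k * (m\<^sup>2 + p\<^sup>2)) = 0"
      using d by algebra
    show "(k * (m * p - n * q))\<^sup>2 + (d - k * (m\<^sup>2 + q\<^sup>2))\<^sup>2 + (- k * (p * q + m * n))\<^sup>2 = d\<^sup>2"
      using d by algebra
    show "(- k * (m * q + n * p))\<^sup>2 + (k * (m * n - p * q))\<^sup>2 + (d - k * (m\<^sup>2 + p\<^sup>2))\<^sup>2 = d\<^sup>2"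
      using d by algebra
  qed
qed

text \<open>N^2 divides N^3 = D^2, so N divides D, and the quotient squares to N.\<close>

lemma cube_square_imp_square:
  fixes N D :: int
  assumes "N ^ 3 = D\<^sup>2" "N \<noteq> 0"
  obtains e where "N = e\<^sup>2"
proof -
  have "N\<^sup>2 dvd D\<^sup>2"
    unfolding assms(1)[symmetric] by (simp add: le_imp_power_dvd)
  then have "N dvd D" by simp
  then obtain e where "D = N * e" ..
  with assms have "N\<^sup>2 * N = N\<^sup>2 * e\<^sup>2"
    by (simp add: power2_eq_square power3_eq_cube algebra_simps)
  with assms(2) have "N = e\<^sup>2" by simp
  then show ?thesis by (rule that)
qed

section \<open>The two directions of the equivalence in \<open>real ^ 3\<close>\<close>

lemma orthoregular_three:
  "orthoregular [u, v, w] \<longleftrightarrow>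
     u \<bullet> v = 0 \<and> u \<bullet> w = 0 \<and> v \<bullet> w = 0 \<and> norm v = norm u \<and> norm w = norm u \<and> u \<noteq> 0"
proof -
  have all: "(\<forall>i < length [u, v, w]. P i) \<longleftrightarrow> P 0 \<and> P 1 \<and> P 2" for P
    by (auto simp: less_Suc_eq numeral_2_eq_2)
  show ?thesis
    using inner_commute[of v u] inner_commute[of w u] inner_commute[of w v]
    unfolding orthoregular_def orthogonal_def all
    by simp (smt (verit) norm_eq_zero)
qed

lemma integer_vectors_3E:
  fixes v :: "real ^ 3"
  assumes "v \<in> integer_vectors"
  obtains a b c :: int where "v = vector [of_int a, of_int b, of_int c]"
proof -
  have "v $ i \<in> \<int>" for i
    using assms unfolding integer_vectors_def by blast
  then obtain a b c :: int where "v $ 1 = of_int a" "v $ 2 = of_int b" "v $ 3 = of_int c"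
    by (meson Ints_cases)
  then have "v = vector [of_int a, of_int b, of_int c]"
    by (simp add: vec_eq_iff forall_3)
  then show ?thesis by (rule that)
qed

lemma vector_of_int_in_integer_vectors:
  "(vector [of_int a, of_int b, of_int c] :: real ^ 3) \<in> integer_vectors"
  by (simp add: integer_vectors_def forall_3)

lemma inner_vector_of_int:
  "(vector [of_int a, of_int b, of_int c] :: real ^ 3) \<bullet> vector [of_int x, of_int y, of_int z]
     = of_int (a * x + b * y + c * z)"
  by (simp add: inner_vec_def sum_3)

lemma integral_norm_imp_orthoregular:
  fixes v :: "real ^ 3"
  assumes "v \<in> integer_vectors" "v \<noteq> 0" "norm v \<in> \<int>"
  shows "\<exists>w1 \<in> integer_vectors. \<exists>w2 \<in> integer_vectors. orthoregular [v, w1, w2]"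
proof -
  obtain a b c :: int where v: "v = vector [of_int a, of_int b, of_int c]"
    using assms(1) by (rule integer_vectors_3E)
  obtain d :: int where d: "norm v = of_int d"
    using assms(3) by (auto elim: Ints_cases)
  have "d \<ge> 0"
    using norm_ge_zero[of v] unfolding d by simp
  have "(of_int (d\<^sup>2) :: real) = of_int (a\<^sup>2 + b\<^sup>2 + c\<^sup>2)"
    using power2_norm_eq_inner[of v] unfolding d unfolding v inner_vector_of_int
    by (simp add: power2_eq_square)
  then have "a\<^sup>2 + b\<^sup>2 + c\<^sup>2 = d\<^sup>2"
    by (simp only: of_int_eq_iff)
  with \<open>d \<ge> 0\<close> obtain a1 b1 c1 a2 b2 c2 :: int where w:
    "a * a1 + b * b1 + c * c1 = 0" "a * a2 + b * b2 + c * c2 = 0"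
    "a1 * a2 + b1 * b2 + c1 * c2 = 0"
    "a1\<^sup>2 + b1\<^sup>2 + c1\<^sup>2 = d\<^sup>2" "a2\<^sup>2 + b2\<^sup>2 + c2\<^sup>2 = d\<^sup>2"
    by (rule integer_triple_completion)
  let ?w1 = "vector [of_int a1, of_int b1, of_int c1] :: real ^ 3"
  let ?w2 = "vector [of_int a2, of_int b2, of_int c2] :: real ^ 3"
  have "norm ?w1 = norm v" "norm ?w2 = norm v"
    using w(4,5) \<open>d \<ge> 0\<close> unfolding d unfolding norm_eq_sqrt_inner inner_vector_of_int power2_eq_square[symmetric]
    by simp_all
  then have "orthoregular [v, ?w1, ?w2]"
    using w(1,2,3) assms(2) unfolding orthoregular_three unfolding v inner_vector_of_int by simp
  then show ?thesis
    using vector_of_int_in_integer_vectors by blast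
qed

lemma orthoregular_imp_integral_norm:
  fixes v w1 w2 :: "real ^ 3"
  assumes int: "v \<in> integer_vectors" "w1 \<in> integer_vectors" "w2 \<in> integer_vectors"
    and ortho: "orthoregular [v, w1, w2]"
  shows "norm v \<in> \<int>"
proof -
  define A :: "real ^ 3 ^ 3" where "A = vector [v, w1, w2]"
  have "det A \<in> \<int>"
    using int unfolding det_3 A_def integer_vectors_def by (auto intro!: Ints_add Ints_diff Ints_mult)
  then obtain D :: int where D: "det A = of_int D"
    by (auto elim: Ints_cases)
  obtain a b c :: int where abc: "v = vector [of_int a, of_int b, of_int c]"
    using int(1) by (rule integer_vectors_3E)
  define N where "N = a * a + b * b + c * c"
  have N: "(norm v)\<^sup>2 = of_int N"
    unfolding power2_norm_eq_inner abc inner_vector_of_int N_def ..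
  have entries: "(A ** transpose A) $ i $ j = A $ i \<bullet> A $ j" for i j
    by (simp add: matrix_matrix_mult_def transpose_def inner_vec_def)
  \<comment> \<open>\<open>A ** transpose A\<close> is the Gram matrix of the rows; orthoregularity
    makes it the scalar matrix with entry |v|^2 = N, of determinant N^3.\<close>
  have "(det A)\<^sup>2 = det (A ** transpose A)"
    by (simp add: det_mul det_transpose power2_eq_square)
  also have "\<dots> = (norm v)\<^sup>2 ^ 3"
    using ortho unfolding det_3 entries orthoregular_three
    by (simp add: A_def inner_commute power2_norm_eq_inner[symmetric] power3_eq_cube)
  finally have "(of_int (N ^ 3) :: real) = of_int (D\<^sup>2)"
    unfolding D N by simp
  then have "N ^ 3 = D\<^sup>2"
    by (simp only: of_int_eq_iff)
  moreover have "N \<noteq> 0"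
    using N ortho unfolding orthoregular_three by auto
  ultimately obtain e where "N = e\<^sup>2"
    by (rule cube_square_imp_square)
  with N have "(norm v)\<^sup>2 = (of_int \<bar>e\<bar>)\<^sup>2" by simp
  then have "norm v = of_int \<bar>e\<bar>"
    by (subst (asm) power2_eq_iff_nonneg) simp_all
  then show ?thesis by simp
qed

section \<open>Sizes of orthoregular systems and the value of E\<close>

lemma orthoregular_length_le:
  fixes T :: "(real ^ 'n) list"
  assumes "orthoregular T"
  shows "length T \<le> CARD('n)"
proof -
  have nth: "orthogonal (T ! i) (T ! j)" if "i < length T" "j < length T" "i \<noteq> j" for i j
    using assms that unfolding orthoregular_def by blast
  have nonzero: "T ! i \<noteq> 0" if "i < length T" for i
    using assms that unfolding orthoregular_def by auto
  \<comment> \<open>A repeated entry would be orthogonal to itself, hence zero.\<close>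
  have "distinct T"
    unfolding distinct_conv_nth using nth nonzero by (metis orthogonal_self)
  have "pairwise orthogonal (set T)"
    unfolding pairwise_def using nth by (metis in_set_conv_nth)
  moreover have "0 \<notin> set T"
    using nonzero by (metis in_set_conv_nth)
  ultimately have "independent (set T)"
    by (rule pairwise_orthogonal_independent)
  then have "card (set T) \<le> CARD('n)"
    using independent_bound by fastforce
  with \<open>distinct T\<close> show ?thesis
    by (simp add: distinct_card)
qed

lemma max_extension_integral_norm:
  fixes v :: "real ^ 3"
  assumes "v \<in> integer_vectors" "v \<noteq> 0" "norm v \<in> \<int>"
  shows "max_extension [v] = 3"
proof -
  let ?L = "{length T | T. orthoregular T \<and> set T \<subseteq> integer_vectors \<and> set [v] \<subseteq> set T}"
  have le: "l \<le> 3" if "l \<in> ?L" for l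
    using that orthoregular_length_le by fastforce
  obtain w1 w2 where "w1 \<in> integer_vectors" "w2 \<in> integer_vectors" "orthoregular [v, w1, w2]"
    using integral_norm_imp_orthoregular[OF assms] by blast
  with assms(1) have "3 \<in> ?L"
    by (intro CollectI exI[of _ "[v, w1, w2]"]) simp
  \<comment> \<open>The dimension bound gives both the finiteness that \<open>Max\<close> requires
    and the maximality of 3.\<close>
  moreover have "finite ?L"
    by (rule finite_subset[of _ "{..3}"]) (use le in auto)
  ultimately show ?thesis
    unfolding max_extension_def using le by (intro Max_eqI)
qed

lemma min_max_extension_integral_3_1: "min_max_extension \<int> TYPE(3) 1 = 3"
proof -
  let ?M = "{max_extension S | S :: (real ^ 3) list.
     orthoregular S \<and> set S \<subseteq> integer_vectors \<and> length S = 1 \<and> system_length S \<in> \<int>}"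
  have "l = 3" if "l \<in> ?M" for l
  proof -
    from that obtain S :: "(real ^ 3) list" where S: "l = max_extension S" "orthoregular S"
        "set S \<subseteq> integer_vectors" "length S = 1" "system_length S \<in> \<int>"
      by blast
    from S(4) obtain v where "S = [v]"
      by (auto simp: length_Suc_conv)
    with S show ?thesis
      by (auto simp: orthoregular_def system_length_def intro: max_extension_integral_norm)
  qed
  \<comment> \<open>A unit vector shows that \<open>?M\<close> is nonempty; otherwise
    \<open>Min\<close> would be applied to the empty set, where its value is unspecified.\<close>
  moreover have "max_extension [axis 1 1 :: real ^ 3] \<in> ?M"
    by (intro CollectI exI[of _ "[axis 1 1]"])
      (simp add: orthoregular_def system_length_def integer_vectors_def axis_def norm_axis_1[unfolded axis_def])
  ultimately have "?M = {3}"
    by (metis (no_types, lifting) insert_absorb singletonI subset_singleton_iff subsetI)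
  then show ?thesis
    unfolding min_max_extension_def by simp
qed

theorem mainTheorem3:
  "(\<forall>v \<in> (integer_vectors :: (real ^ 3) set). v \<noteq> 0 \<longrightarrow>
      ((\<exists>w1 \<in> integer_vectors. \<exists>w2 \<in> integer_vectors. orthoregular [v, w1, w2])
        \<longleftrightarrow> norm v \<in> \<int>)) \<and>
   min_max_extension \<int> TYPE(3) 1 = 3"
proof (intro conjI ballI impI iffI)
  fix v :: "real ^ 3"
  assume "v \<in> integer_vectors" "v \<noteq> 0" "norm v \<in> \<int>"
  then show "\<exists>w1 \<in> integer_vectors. \<exists>w2 \<in> integer_vectors. orthoregular [v, w1, w2]"
    by (rule integral_norm_imp_orthoregular)
next
  fix v :: "real ^ 3"
  assume "v \<in> integer_vectors" "\<exists>w1 \<in> integer_vectors. \<exists>w2 \<in> integer_vectors. orthoregular [v, w1, w2]"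
  then show "norm v \<in> \<int>"
    using orthoregular_imp_integral_norm by blast
qed (rule min_max_extension_integral_3_1)

end
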